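(* Any extension of a virtually solvable of derived length $s$ group by a virtually solvable of derived length $t$ group is virtually solvable of derived length $\le t+s+1$. That is, if a group $G$ has a normal subgroup $A$ such that $A$ is virtually solvable of derived length $s$ and $G/A$ is virtually solvable of derived length $t$, then $G$ contains a finite-index subgroup which is solvable of derived length at most $t+s+1$.
   Context: A group is virtually solvable of derived length $k$ if it contains a finite-index subgroup that is solvable of derived length $k$; the trivial group has derived length $0$, so finite groups are virtually solvable of derived length $0$. *)

theory Defs
  imports "HOL-Algebra.Solvable_Groups"
begin

definition finite_index_subgroup :: "'a set \<Rightarrow> ('a, 'b) monoid_scheme \<Rightarrow> bool"
  where "finite_index_subgroup H G \<longleftrightarrow> subgroup H G \<and> finite (rcosets\<^bsub>G\<^esub> H)"

(* Only meaningful for solvable G, where the derived series reaches the trivial subgroup. *)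
definition derived_length :: "('a, 'b) monoid_scheme \<Rightarrow> nat"
  where "derived_length G = (LEAST n. (derived G ^^ n) (carrier G) = {\<one>\<^bsub>G\<^esub>})"

(* The derived length of the finite-index subgroup is required to be exactly k. *)
definition virtually_solvable_of_derived_length :: "('a, 'b) monoid_scheme \<Rightarrow> nat \<Rightarrow> bool"
  where "virtually_solvable_of_derived_length G k \<longleftrightarrow>
    (\<exists>H. finite_index_subgroup H G \<and> solvable (G\<lparr>carrier := H\<rparr>) \<and>
         derived_length (G\<lparr>carrier := H\<rparr>) = k)"

lemma (in group) finite_imp_virtually_solvable_of_derived_length_0:
  assumes "finite (carrier G)"
  shows "virtually_solvable_of_derived_length G 0"
proof -
  have "finite (rcosets {\<one>})"
    using assms by (simp add: RCOSETS_def)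
  hence "finite_index_subgroup {\<one>} G"
    by (simp add: finite_index_subgroup_def triv_subgroup)
  moreover have "solvable (G\<lparr>carrier := {\<one>}\<rparr>)"
    using solvable_seq.unity[of "G\<lparr>carrier := {\<one>}\<rparr>"] by (simp add: solvable_def)
  moreover have "derived_length (G\<lparr>carrier := {\<one>}\<rparr>) = 0"
    by (simp add: derived_length_def)
  ultimately show ?thesis
    unfolding virtually_solvable_of_derived_length_def by blast
qed

end

theory Submission
  imports Defs
begin

text \<open>
  The subgroup \<open>A\<close> has a subgroup of finite index and derived length \<open>s\<close>, but \<open>G\<close> need not
  normalize it, and since \<open>A\<close> need not be finitely generated its conjugates may be infinitely many,
  with an intersection of infinite index. The heart of the proof replaces it by a subgroup \<open>C\<close> that
  is characteristic in \<open>A\<close>, hence normal in \<open>G\<close>, still of finite index and with trivial \<open>s\<close>-th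
  derived subgroup (\<open>finite_index_characteristic_of_derived_length\<close>). This is the
  Khukhro--Makarenko theorem for the derived words, by a variant of the argument of Klyachko and
  Mel'nikova.

  Given \<open>C\<close>, two subgroups of finite index in \<open>G\<close> are intersected: the centralizer \<open>K\<close> of the
  finite section \<open>A / C\<close> (\<open>finite_index_centralizer_of_finite_section\<close>), and the preimage of a
  finite-index subgroup of \<open>G / A\<close> of derived length \<open>t\<close>. The \<open>t\<close>-th derived subgroup of the intersection lies in
  \<open>A \<inter> K\<close>, which is central modulo \<open>C\<close>; one more commutator therefore lands in \<open>C\<close>, and \<open>s\<close> further
  ones reach the identity. The summand \<open>1\<close> in the bound is the price of the finite section \<open>A / C\<close>.

  For the characteristic subgroup, view the \<open>n\<close>-th derived subgroup as a binary tree of commutators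
  with \<open>2 ^ n\<close> leaves and put a normal subgroup at each leaf. Its value is multilinear: it distributes
  over joins at each leaf (\<open>commutator_tree_join\<close>). Suppose that the tree is trivial with a
  characteristic \<open>R\<close> at some leaves and a normal \<open>N \<subseteq> R\<close> of finite index at the others. Let \<open>R'\<close>
  be the join of all automorphic images of \<open>N\<close>. Because \<open>N\<close> has finite index, finitely many images
  \<open>\<phi> ` N\<close> already generate \<open>R'\<close> (\<open>generate_Union_finite_subfamily\<close>); let \<open>N'\<close> be their
  intersection. Placing \<open>R'\<close> at one more leaf, and \<open>R'\<close>, \<open>N'\<close> instead of \<open>R\<close>, \<open>N\<close> elsewhere,
  still gives the trivial group: by multilinearity \<open>R'\<close> at the new leaf may be replaced by some
  \<open>\<phi> ` N\<close>, and then the tree is contained in the \<open>\<phi>\<close>-image of the old one, since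
  \<open>R' \<subseteq> R = \<phi> ` R\<close> and \<open>N' \<subseteq> \<phi> ` N\<close>. Once all leaves are exhausted
  (\<open>commutator_tree_enlarge_leaves\<close>), a characteristic subgroup sits at every leaf.
\<close>

section \<open>Subgroups of finite index\<close>

lemma (in group) mult_inv_cancel:
  "\<lbrakk>x \<in> carrier G; y \<in> carrier G\<rbrakk> \<Longrightarrow> x \<otimes> (inv x \<otimes> y) = y"
  by (simp flip: m_assoc)

lemma (in group) inv_mult_cancel:
  "\<lbrakk>x \<in> carrier G; y \<in> carrier G\<rbrakk> \<Longrightarrow> inv x \<otimes> (x \<otimes> y) = y"
  by (simp flip: m_assoc)

lemma (in group) rcos_eq_iff:
  assumes "subgroup H G" "x \<in> carrier G" "y \<in> carrier G"
  shows "H #> x = H #> y \<longleftrightarrow> x \<otimes> inv y \<in> H"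
proof
  assume "H #> x = H #> y"
  with rcos_self[OF assms(2,1)] have "x \<in> H #> y" by simp
  then obtain h where h: "h \<in> H" "x = h \<otimes> y" by (auto simp: r_coset_def)
  with assms subgroup.mem_carrier[OF assms(1) h(1)] show "x \<otimes> inv y \<in> H"
    by (simp add: m_assoc)
next
  assume h: "x \<otimes> inv y \<in> H"
  have "x = (x \<otimes> inv y) \<otimes> y" using assms by (simp add: m_assoc)
  with h have "x \<in> H #> y" by (auto simp: r_coset_def)
  from repr_independence[OF this assms(3,1)] show "H #> x = H #> y" by simp
qed

text \<open>Finitely many labels that separate the cosets suffice, and for intersections, preimages and
  kernels of actions such labels are easier to find than the cosets themselves.\<close>

lemma (in group) finite_index_subgroupI:
  assumes H: "subgroup H G" and fin: "finite (f ` carrier G)"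
    and f: "\<And>x y. \<lbrakk>x \<in> carrier G; y \<in> carrier G; f x = f y\<rbrakk> \<Longrightarrow> x \<otimes> inv y \<in> H"
  shows "finite_index_subgroup H G"
proof -
  \<comment> \<open>A label determines the coset of any element that carries it.\<close>
  let ?r = "\<lambda>c. H #> (SOME x. x \<in> carrier G \<and> f x = c)"
  have "H #> x \<in> ?r ` (f ` carrier G)" if x: "x \<in> carrier G" for x
  proof -
    let ?y = "SOME y. y \<in> carrier G \<and> f y = f x"
    have y: "?y \<in> carrier G \<and> f ?y = f x" by (rule someI[of _ x]) (simp add: x)
    then have "H #> x = H #> ?y"
      using rcos_eq_iff[OF H x] f[OF x, of ?y] by metis
    with x show ?thesis by blast
  qed
  then have "rcosets H \<subseteq> ?r ` (f ` carrier G)" by (auto simp: RCOSETS_def)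
  with fin H show ?thesis unfolding finite_index_subgroup_def by (meson finite_surj)
qed

lemma finite_rcosets_image:
  assumes "finite_index_subgroup H G"
  shows "finite ((\<lambda>x. H #>\<^bsub>G\<^esub> x) ` carrier G)"
proof -
  have "(\<lambda>x. H #>\<^bsub>G\<^esub> x) ` carrier G = rcosets\<^bsub>G\<^esub> H" by (auto simp: RCOSETS_def)
  with assms show ?thesis by (simp add: finite_index_subgroup_def)
qed

lemma finite_index_subgroup_imp_subgroup: "finite_index_subgroup H G \<Longrightarrow> subgroup H G"
  by (simp add: finite_index_subgroup_def)

lemma (in group) finite_index_superset:
  assumes "finite_index_subgroup H G" "subgroup K G" "H \<subseteq> K"
  shows "finite_index_subgroup K G"
proof (rule finite_index_subgroupI[OF assms(2) finite_rcosets_image[OF assms(1)]])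
  show "x \<otimes> inv y \<in> K" if "x \<in> carrier G" "y \<in> carrier G" "H #> x = H #> y" for x y
    using rcos_eq_iff[OF finite_index_subgroup_imp_subgroup[OF assms(1)] that(1,2)] that(3) assms(3)
    by blast
qed

lemma (in group) finite_index_Int:
  assumes H: "finite_index_subgroup H G" and K: "finite_index_subgroup K G"
  shows "finite_index_subgroup (H \<inter> K) G"
proof (rule finite_index_subgroupI[where f = "\<lambda>x. (H #> x, K #> x)"])
  have sub: "subgroup H G" "subgroup K G"
    using H K by (simp_all add: finite_index_subgroup_imp_subgroup)
  then show "subgroup (H \<inter> K) G" by (rule subgroups_Inter_pair)
  have "(\<lambda>x. (H #> x, K #> x)) ` carrier G
      \<subseteq> ((\<lambda>x. H #> x) ` carrier G) \<times> ((\<lambda>x. K #> x) ` carrier G)" by auto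
  then show "finite ((\<lambda>x. (H #> x, K #> x)) ` carrier G)"
    by (rule finite_subset) (simp add: H K finite_rcosets_image)
  show "x \<otimes> inv y \<in> H \<inter> K"
    if "x \<in> carrier G" "y \<in> carrier G" "(H #> x, K #> x) = (H #> y, K #> y)" for x y
    using that sub by (simp add: rcos_eq_iff)
qed

lemma (in group) finite_index_normal_Inter:
  assumes "finite F" "F \<noteq> {}" "\<And>N. N \<in> F \<Longrightarrow> finite_index_subgroup N G \<and> N \<lhd> G"
  shows "finite_index_subgroup (\<Inter>F) G \<and> \<Inter>F \<lhd> G"
  using assms
proof (induction F rule: finite_ne_induct)
  case (insert N F)
  then have N: "finite_index_subgroup N G" "N \<lhd> G"
    and F: "finite_index_subgroup (\<Inter>F) G" "\<Inter>F \<lhd> G" by auto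
  have "N \<inter> \<Inter>F \<lhd> G"
    using finite_index_subgroup_imp_subgroup[OF finite_index_Int[OF N(1) F(1)]] N(2) F(2)
    by (auto simp: normal_inv_iff)
  with finite_index_Int[OF N(1) F(1)] show ?case by simp
qed auto

lemma (in group_hom) finite_index_preimage:
  assumes K: "finite_index_subgroup K H"
  shows "finite_index_subgroup {x \<in> carrier G. h x \<in> K} G"
proof (rule G.finite_index_subgroupI[where f = "\<lambda>x. K #>\<^bsub>H\<^esub> h x"])
  have sub: "subgroup K H" using K by (rule finite_index_subgroup_imp_subgroup)
  show "subgroup {x \<in> carrier G. h x \<in> K} G"
    using sub by (intro G.subgroupI)
      (auto simp: subgroup.m_closed subgroup.m_inv_closed subgroup.one_closed intro: exI[of _ \<one>])
  have "(\<lambda>x. K #>\<^bsub>H\<^esub> h x) ` carrier G \<subseteq> (\<lambda>y. K #>\<^bsub>H\<^esub> y) ` carrier H" by auto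
  then show "finite ((\<lambda>x. K #>\<^bsub>H\<^esub> h x) ` carrier G)"
    by (rule finite_subset) (rule finite_rcosets_image[OF K])
  show "x \<otimes> inv y \<in> {x \<in> carrier G. h x \<in> K}"
    if "x \<in> carrier G" "y \<in> carrier G" "K #>\<^bsub>H\<^esub> h x = K #>\<^bsub>H\<^esub> h y" for x y
    using that H.rcos_eq_iff[OF sub] by simp
qed

text \<open>The core is the kernel of the action of the group by right multiplication on the finite set
  of cosets, so finitely many permutations tell its cosets apart.\<close>

lemma (in group) finite_index_normal_core:
  assumes H: "finite_index_subgroup H G"
  obtains N where "N \<subseteq> H" "N \<lhd> G" "finite_index_subgroup N G"
proof
  define N where "N = {x \<in> carrier G. \<forall>g\<in>carrier G. g \<otimes> x \<otimes> inv g \<in> H}"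
  have sub: "subgroup H G" using H by (rule finite_index_subgroup_imp_subgroup)
  show "N \<subseteq> H"
  proof
    fix x assume x: "x \<in> N"
    then have "\<one> \<otimes> x \<otimes> inv \<one> \<in> H" unfolding N_def by blast
    with x show "x \<in> H" by (simp add: N_def)
  qed
  have subN: "subgroup N G"
  proof (rule subgroupI)
    show "N \<subseteq> carrier G" by (auto simp: N_def)
    have "\<one> \<in> N" using sub by (simp add: N_def subgroup.one_closed)
    then show "N \<noteq> {}" by blast
    show "inv x \<in> N" if x: "x \<in> N" for x
      unfolding N_def
    proof (safe)
      show "inv x \<in> carrier G" using x by (simp add: N_def)
      fix g assume g: "g \<in> carrier G"
      have "g \<otimes> inv x \<otimes> inv g = inv (g \<otimes> x \<otimes> inv g)"
        using x g by (simp add: N_def inv_mult_group m_assoc)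
      with x g sub show "g \<otimes> inv x \<otimes> inv g \<in> H"
        by (simp add: N_def subgroup.m_inv_closed)
    qed
    show "x \<otimes> y \<in> N" if x: "x \<in> N" and y: "y \<in> N" for x y
      unfolding N_def
    proof (safe)
      show "x \<otimes> y \<in> carrier G" using x y by (simp add: N_def)
      fix g assume g: "g \<in> carrier G"
      have "g \<otimes> (x \<otimes> y) \<otimes> inv g = (g \<otimes> x \<otimes> inv g) \<otimes> (g \<otimes> y \<otimes> inv g)"
        using x y g by (simp add: N_def m_assoc mult_inv_cancel inv_mult_cancel)
      with x y g sub show "g \<otimes> (x \<otimes> y) \<otimes> inv g \<in> H"
        by (simp add: N_def subgroup.m_closed)
    qed
  qed
  show "N \<lhd> G"
  proof (rule normal_invI[OF subN])
    fix g x assume g: "g \<in> carrier G" and x: "x \<in> N"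
    have "k \<otimes> (g \<otimes> x \<otimes> inv g) \<otimes> inv k = (k \<otimes> g) \<otimes> x \<otimes> inv (k \<otimes> g)" if "k \<in> carrier G" for k
      using x g that by (simp add: N_def m_assoc inv_mult_group)
    with g x show "g \<otimes> x \<otimes> inv g \<in> N" by (auto simp: N_def)
  qed
  show "finite_index_subgroup N G"
  proof (rule finite_index_subgroupI[OF subN, where f = "\<lambda>x. \<lambda>C\<in>rcosets H. C #> x"])
    have eq: "(H #> g) #> x = H #> (g \<otimes> x)" if "g \<in> carrier G" "x \<in> carrier G" for g x
      using coset_mult_assoc[OF subgroup.subset[OF sub]] that by simp
    have "(\<lambda>x. \<lambda>C\<in>rcosets H. C #> x) ` carrier G \<subseteq> rcosets H \<rightarrow>\<^sub>E rcosets H"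
    proof (intro image_subsetI restrict_PiE_iff[THEN iffD2] ballI)
      fix x C assume x: "x \<in> carrier G" and "C \<in> rcosets H"
      then obtain g where "g \<in> carrier G" "C = H #> g" by (auto simp: RCOSETS_def)
      with x show "C #> x \<in> rcosets H" by (auto simp: RCOSETS_def eq)
    qed
    moreover have "finite (rcosets H \<rightarrow>\<^sub>E rcosets H)"
      using H by (auto simp: finite_index_subgroup_def intro: finite_PiE)
    ultimately show "finite ((\<lambda>x. \<lambda>C\<in>rcosets H. C #> x) ` carrier G)"
      by (rule finite_subset)
    fix x y assume x: "x \<in> carrier G" and y: "y \<in> carrier G"
      and xy: "(\<lambda>C\<in>rcosets H. C #> x) = (\<lambda>C\<in>rcosets H. C #> y)"
    have "g \<otimes> (x \<otimes> inv y) \<otimes> inv g \<in> H" if g: "g \<in> carrier G" for g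
    proof -
      have "H #> g \<in> rcosets H" using g by (auto simp: RCOSETS_def)
      then have "(H #> g) #> x = (H #> g) #> y" using fun_cong[OF xy, of "H #> g"] by simp
      then have "(g \<otimes> x) \<otimes> inv (g \<otimes> y) \<in> H"
        using g x y by (simp add: eq rcos_eq_iff[OF sub])
      with g x y show ?thesis by (simp add: m_assoc inv_mult_group)
    qed
    with x y show "x \<otimes> inv y \<in> N" by (simp add: N_def)
  qed
qed

lemma (in group) generate_Union_finite_support:
  assumes "x \<in> generate G (\<Union>\<M>)"
  shows "\<exists>F. finite F \<and> F \<subseteq> \<M> \<and> x \<in> generate G (\<Union>F)"
  using assms
proof induction
  case one
  show ?case by (intro exI[of _ "{}"]) (simp add: generate.one)
next
  case (incl h)
  then obtain M where "M \<in> \<M>" "h \<in> M" by blast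
  then show ?case by (intro exI[of _ "{M}"]) (simp add: generate.incl)
next
  case (inv h)
  then obtain M where "M \<in> \<M>" "h \<in> M" by blast
  then show ?case by (intro exI[of _ "{M}"]) (simp add: generate.inv)
next
  case (eng x y)
  then obtain E F where "finite E" "E \<subseteq> \<M>" "x \<in> generate G (\<Union>E)"
    and "finite F" "F \<subseteq> \<M>" "y \<in> generate G (\<Union>F)" by blast
  moreover have "generate G (\<Union>E) \<subseteq> generate G (\<Union>(E \<union> F))"
    "generate G (\<Union>F) \<subseteq> generate G (\<Union>(E \<union> F))" by (intro mono_generate; blast)+
  ultimately have "finite (E \<union> F) \<and> E \<union> F \<subseteq> \<M> \<and> x \<otimes> y \<in> generate G (\<Union>(E \<union> F))"
    by (meson finite_UnI generate.eng le_sup_iff subset_iff)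
  then show ?case by blast
qed

text \<open>A join that contains a subgroup of finite index is a union of finitely many of its cosets,
  and the representative of each involves only finitely many members of the family.\<close>

lemma (in group) generate_Union_finite_subfamily:
  assumes N: "finite_index_subgroup N G" "N \<in> \<M>" and \<M>: "\<And>M. M \<in> \<M> \<Longrightarrow> M \<subseteq> carrier G"
  obtains F where "finite F" "F \<subseteq> \<M>" "N \<in> F" "generate G (\<Union>F) = generate G (\<Union>\<M>)"
proof -
  define R where "R = generate G (\<Union>\<M>)"
  have subN: "subgroup N G" using N(1) by (rule finite_index_subgroup_imp_subgroup)
  have RG: "R \<subseteq> carrier G" unfolding R_def using \<M> by (intro generate_incl) blast
  have "finite ((\<lambda>x. N #> x) ` R)"
    by (rule finite_subset[OF image_mono[OF RG] finite_rcosets_image[OF N(1)]])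
  then obtain X where X: "X \<subseteq> R" "finite X" "(\<lambda>x. N #> x) ` R = (\<lambda>x. N #> x) ` X"
    by (meson finite_subset_image order_refl)
  have "\<forall>x\<in>X. \<exists>F. finite F \<and> F \<subseteq> \<M> \<and> x \<in> generate G (\<Union>F)"
    using X(1) generate_Union_finite_support unfolding R_def by blast
  then obtain S where S: "\<And>x. x \<in> X \<Longrightarrow> finite (S x) \<and> S x \<subseteq> \<M> \<and> x \<in> generate G (\<Union>(S x))"
    by metis
  \<comment> \<open>Besides the supports of the representatives, \<open>N\<close> itself is needed to fill up the cosets.\<close>
  define F where "F = insert N (\<Union>x\<in>X. S x)"
  have F: "finite F" "F \<subseteq> \<M>" "N \<in> F" using S X(2) N(2) by (auto simp: F_def)
  have "R \<subseteq> generate G (\<Union>F)"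
  proof
    fix r assume r: "r \<in> R"
    then obtain x where x: "x \<in> X" "N #> r = N #> x" using X(3) by (metis imageE imageI)
    with rcos_self[OF _ subN, of r] r RG have "r \<in> N #> x" by auto
    then obtain n where n: "n \<in> N" "r = n \<otimes> x" by (auto simp: r_coset_def)
    have "generate G (\<Union>(S x)) \<subseteq> generate G (\<Union>F)"
      by (rule mono_generate) (use x in \<open>auto simp: F_def\<close>)
    then have "x \<in> generate G (\<Union>F)" using S[OF x(1)] by blast
    moreover have "n \<in> generate G (\<Union>F)" using n F(3) by (blast intro: generate.incl)
    ultimately show "r \<in> generate G (\<Union>F)" unfolding n(2) by (blast intro: generate.eng)
  qed
  moreover have "generate G (\<Union>F) \<subseteq> R" unfolding R_def by (rule mono_generate) (use F in blast)
  ultimately show ?thesis using that F unfolding R_def by blast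
qed


section \<open>Iterated mutual commutators\<close>

definition commutator_subgroup :: "('a, 'b) monoid_scheme \<Rightarrow> 'a set \<Rightarrow> 'a set \<Rightarrow> 'a set"
  where "commutator_subgroup G H K =
    generate G (\<Union>h\<in>H. \<Union>k\<in>K. {h \<otimes>\<^bsub>G\<^esub> k \<otimes>\<^bsub>G\<^esub> inv\<^bsub>G\<^esub> h \<otimes>\<^bsub>G\<^esub> inv\<^bsub>G\<^esub> k})"

text \<open>This is the value of the \<open>n\<close>-th derived word, a complete binary tree of commutators of depth
  \<open>n\<close>, whose \<open>2 ^ n\<close> leaves carry possibly different subgroups. A leaf is addressed by the path
  that leads to it.\<close>

fun commutator_tree ::
    "('a, 'b) monoid_scheme \<Rightarrow> nat \<Rightarrow> (bool list \<Rightarrow> 'a set) \<Rightarrow> 'a set" where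
  "commutator_tree G 0 f = f []"
| "commutator_tree G (Suc n) f =
     commutator_subgroup G (commutator_tree G n (\<lambda>p. f (True # p)))
                           (commutator_tree G n (\<lambda>p. f (False # p)))"

lemma (in group) commutators_subset_carrier:
  assumes "H \<subseteq> carrier G" "K \<subseteq> carrier G"
  shows "(\<Union>h\<in>H. \<Union>k\<in>K. {h \<otimes> k \<otimes> inv h \<otimes> inv k}) \<subseteq> carrier G"
proof -
  have "h \<otimes> k \<otimes> inv h \<otimes> inv k \<in> carrier G" if "h \<in> H" "k \<in> K" for h k
  proof -
    have "h \<in> carrier G" "k \<in> carrier G" using that assms by auto
    then show ?thesis by simp
  qed
  then show ?thesis by blast
qed

lemma (in group) commutator_subgroup_mono:
  "\<lbrakk>H \<subseteq> H'; K \<subseteq> K'\<rbrakk> \<Longrightarrow> commutator_subgroup G H K \<subseteq> commutator_subgroup G H' K'"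
  unfolding commutator_subgroup_def by (rule mono_generate) blast

lemma (in group) commutator_subgroup_normal:
  assumes H: "H \<lhd> G" and K: "K \<lhd> G"
  shows "commutator_subgroup G H K \<lhd> G"
proof -
  have HK: "H \<subseteq> carrier G" "K \<subseteq> carrier G"
    using H K normal_imp_subgroup subgroup.subset by blast+
  show ?thesis unfolding commutator_subgroup_def
  proof (rule normal_generateI)
    show "(\<Union>h\<in>H. \<Union>k\<in>K. {h \<otimes> k \<otimes> inv h \<otimes> inv k}) \<subseteq> carrier G"
      using HK by (rule commutators_subset_carrier)
    fix c g assume "c \<in> (\<Union>h\<in>H. \<Union>k\<in>K. {h \<otimes> k \<otimes> inv h \<otimes> inv k})" and g: "g \<in> carrier G"
    then obtain h k where hk: "h \<in> H" "k \<in> K" and c: "c = h \<otimes> k \<otimes> inv h \<otimes> inv k" by blast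
    have car: "h \<in> carrier G" "k \<in> carrier G" using hk HK by auto
    have "g \<otimes> c \<otimes> inv g = (g \<otimes> h \<otimes> inv g) \<otimes> (g \<otimes> k \<otimes> inv g)
        \<otimes> inv (g \<otimes> h \<otimes> inv g) \<otimes> inv (g \<otimes> k \<otimes> inv g)"
      using g car by (simp add: c m_assoc inv_mult_group mult_inv_cancel inv_mult_cancel)
    moreover have "g \<otimes> h \<otimes> inv g \<in> H" "g \<otimes> k \<otimes> inv g \<in> K"
      using H K g hk by (auto simp: normal_inv_iff)
    ultimately show "g \<otimes> c \<otimes> inv g \<in> (\<Union>h\<in>H. \<Union>k\<in>K. {h \<otimes> k \<otimes> inv h \<otimes> inv k})"
      by blast
  qed
qed

lemma (in group) commutator_tree_normal:
  "(\<And>p. f p \<lhd> G) \<Longrightarrow> commutator_tree G n f \<lhd> G"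
proof (induction n arbitrary: f)
  case (Suc n)
  show ?case by (simp add: commutator_subgroup_normal Suc)
qed simp

lemma (in group) commutator_tree_mono:
  "(\<And>p. length p = n \<Longrightarrow> f p \<subseteq> g p) \<Longrightarrow> commutator_tree G n f \<subseteq> commutator_tree G n g"
proof (induction n arbitrary: f g)
  case (Suc n)
  show ?case unfolding commutator_tree.simps
    by (intro commutator_subgroup_mono Suc.IH Suc.prems) simp_all
qed simp

lemma commutator_tree_const: "commutator_tree G n (\<lambda>_. H) = (derived G ^^ n) H"
  by (induction n) (simp_all add: commutator_subgroup_def derived_def)

lemma (in group_hom) commutator_subgroup_img:
  assumes "X \<subseteq> carrier G" "Y \<subseteq> carrier G"
  shows "commutator_subgroup H (h ` X) (h ` Y) = h ` commutator_subgroup G X Y"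
proof -
  let ?S = "\<Union>x\<in>X. \<Union>y\<in>Y. {x \<otimes> y \<otimes> inv x \<otimes> inv y}"
  have "h (x \<otimes> y \<otimes> inv x \<otimes> inv y) =
      h x \<otimes>\<^bsub>H\<^esub> h y \<otimes>\<^bsub>H\<^esub> inv\<^bsub>H\<^esub> (h x) \<otimes>\<^bsub>H\<^esub> inv\<^bsub>H\<^esub> (h y)" if "x \<in> X" "y \<in> Y" for x y
  proof -
    have "x \<in> carrier G" "y \<in> carrier G" using that assms by auto
    then show ?thesis by simp
  qed
  then have "(\<Union>u\<in>h ` X. \<Union>v\<in>h ` Y. {u \<otimes>\<^bsub>H\<^esub> v \<otimes>\<^bsub>H\<^esub> inv\<^bsub>H\<^esub> u \<otimes>\<^bsub>H\<^esub> inv\<^bsub>H\<^esub> v}) = h ` ?S"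
    by (simp add: image_UN)
  moreover have "?S \<subseteq> carrier G" using assms by (rule G.commutators_subset_carrier)
  ultimately show ?thesis
    unfolding commutator_subgroup_def by (simp only: generate_img)
qed

lemma (in group_hom) commutator_tree_img:
  assumes "\<And>p. f p \<lhd> G"
  shows "commutator_tree H n (\<lambda>p. h ` f p) = h ` commutator_tree G n f"
  using assms
proof (induction n arbitrary: f)
  case (Suc n)
  have "commutator_tree G n (\<lambda>p. f (b # p)) \<subseteq> carrier G" for b
    using G.commutator_tree_normal[of "\<lambda>p. f (b # p)"] Suc.prems
    by (meson normal_imp_subgroup subgroup.subset)
  with Suc show ?case by (simp add: commutator_subgroup_img)
qed simp

text \<open>For normal \<open>Y\<close> and \<open>T\<close>, the inclusion \<open>[X, Y] \<subseteq> T\<close> says that \<open>X\<close> lies in the following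
  subgroup. It is the adjoint to \<open>X \<mapsto> [X, Y]\<close> that makes mutual commutators distribute over
  joins.\<close>

definition commutator_residual :: "('a, 'b) monoid_scheme \<Rightarrow> 'a set \<Rightarrow> 'a set \<Rightarrow> 'a set"
  where "commutator_residual G Y T =
    {x \<in> carrier G. \<forall>y\<in>Y. x \<otimes>\<^bsub>G\<^esub> y \<otimes>\<^bsub>G\<^esub> inv\<^bsub>G\<^esub> x \<otimes>\<^bsub>G\<^esub> inv\<^bsub>G\<^esub> y \<in> T}"

lemma (in group) commutator_residual_normal:
  assumes Y: "Y \<lhd> G" and T: "T \<lhd> G"
  shows "commutator_residual G Y T \<lhd> G"
proof (rule normal_invI)
  let ?C = "commutator_residual G Y T"
  have YG: "Y \<subseteq> carrier G" and subT: "subgroup T G"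
    using Y T normal_imp_subgroup subgroup.subset by blast+
  have conjY: "g \<otimes> y \<otimes> inv g \<in> Y" if "g \<in> carrier G" "y \<in> Y" for g y
    using Y that by (auto simp: normal_inv_iff)
  have conjT: "g \<otimes> y \<otimes> inv g \<in> T" if "g \<in> carrier G" "y \<in> T" for g y
    using T that by (auto simp: normal_inv_iff)
  have commT: "x \<otimes> y \<otimes> inv x \<otimes> inv y \<in> T" if "x \<in> ?C" "y \<in> Y" for x y
    using that by (auto simp: commutator_residual_def)
  have CG: "x \<in> carrier G" if "x \<in> ?C" for x
    using that by (auto simp: commutator_residual_def)
  show "subgroup ?C G"
  proof (rule subgroupI)
    show "?C \<subseteq> carrier G" using CG by blast
    have "\<one> \<in> ?C" using YG subgroup.one_closed[OF subT] by (auto simp: commutator_residual_def)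
    then show "?C \<noteq> {}" by blast
    show "inv x \<in> ?C" if x: "x \<in> ?C" for x
      unfolding commutator_residual_def
    proof (safe)
      show "inv x \<in> carrier G" using CG[OF x] by simp
      fix y assume y: "y \<in> Y"
      have car: "x \<in> carrier G" "y \<in> carrier G" using CG[OF x] y YG by auto
      have "inv x \<otimes> y \<otimes> inv (inv x) \<otimes> inv y
          = inv x \<otimes> inv (x \<otimes> y \<otimes> inv x \<otimes> inv y) \<otimes> inv (inv x)"
        using car by (simp add: m_assoc inv_mult_group mult_inv_cancel inv_mult_cancel)
      moreover have "inv (x \<otimes> y \<otimes> inv x \<otimes> inv y) \<in> T"
        using commT[OF x y] subgroup.m_inv_closed[OF subT] by blast
      ultimately show "inv x \<otimes> y \<otimes> inv (inv x) \<otimes> inv y \<in> T"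
        using conjT[of "inv x"] car by simp
    qed
    show "x \<otimes> z \<in> ?C" if x: "x \<in> ?C" and z: "z \<in> ?C" for x z
      unfolding commutator_residual_def
    proof (safe)
      show "x \<otimes> z \<in> carrier G" using CG x z by simp
      fix y assume y: "y \<in> Y"
      have car: "x \<in> carrier G" "y \<in> carrier G" "z \<in> carrier G" using CG x z y YG by auto
      have "x \<otimes> z \<otimes> y \<otimes> inv (x \<otimes> z) \<otimes> inv y
          = (x \<otimes> (z \<otimes> y \<otimes> inv z \<otimes> inv y) \<otimes> inv x) \<otimes> (x \<otimes> y \<otimes> inv x \<otimes> inv y)"
        using car by (simp add: m_assoc inv_mult_group mult_inv_cancel inv_mult_cancel)
      then show "x \<otimes> z \<otimes> y \<otimes> inv (x \<otimes> z) \<otimes> inv y \<in> T"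
        using conjT[OF car(1) commT[OF z y]] commT[OF x y] subgroup.m_closed[OF subT] by simp
    qed
  qed
  fix g x assume g: "g \<in> carrier G" and x: "x \<in> ?C"
  show "g \<otimes> x \<otimes> inv g \<in> ?C"
    unfolding commutator_residual_def
  proof (safe)
    show "g \<otimes> x \<otimes> inv g \<in> carrier G" using g CG[OF x] by simp
    fix y assume y: "y \<in> Y"
    have car: "x \<in> carrier G" "y \<in> carrier G" using CG[OF x] y YG by auto
    let ?y = "inv g \<otimes> y \<otimes> inv (inv g)"
    have "(g \<otimes> x \<otimes> inv g) \<otimes> y \<otimes> inv (g \<otimes> x \<otimes> inv g) \<otimes> inv y
        = g \<otimes> (x \<otimes> ?y \<otimes> inv x \<otimes> inv ?y) \<otimes> inv g"
      using g car by (simp add: m_assoc inv_mult_group mult_inv_cancel inv_mult_cancel)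
    moreover have "?y \<in> Y" using conjY[of "inv g"] g y by simp
    ultimately show "(g \<otimes> x \<otimes> inv g) \<otimes> y \<otimes> inv (g \<otimes> x \<otimes> inv g) \<otimes> inv y \<in> T"
      using conjT[OF g commT[OF x]] by simp
  qed
qed

lemma (in group) commutator_subgroup_subset_iff:
  assumes "X \<subseteq> carrier G" "subgroup T G"
  shows "commutator_subgroup G X Y \<subseteq> T \<longleftrightarrow> X \<subseteq> commutator_residual G Y T"
proof
  assume "commutator_subgroup G X Y \<subseteq> T"
  then show "X \<subseteq> commutator_residual G Y T"
    using assms(1) unfolding commutator_subgroup_def commutator_residual_def
    by (auto intro: generate.incl)
next
  assume "X \<subseteq> commutator_residual G Y T"
  then show "commutator_subgroup G X Y \<subseteq> T"
    unfolding commutator_subgroup_def commutator_residual_def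
    by (intro generate_subgroup_incl[OF _ assms(2)]) auto
qed

lemma (in group) commutator_subgroup_commute_subset:
  assumes "X \<subseteq> carrier G" "Y \<subseteq> carrier G"
  shows "commutator_subgroup G X Y \<subseteq> commutator_subgroup G Y X"
proof -
  have YX: "(\<Union>y\<in>Y. \<Union>x\<in>X. {y \<otimes> x \<otimes> inv y \<otimes> inv x}) \<subseteq> carrier G"
    using assms(2,1) by (rule commutators_subset_carrier)
  have "x \<otimes> y \<otimes> inv x \<otimes> inv y \<in> commutator_subgroup G Y X" if "x \<in> X" "y \<in> Y" for x y
  proof -
    have "x \<in> carrier G" "y \<in> carrier G" using that assms by auto
    then have "x \<otimes> y \<otimes> inv x \<otimes> inv y = inv (y \<otimes> x \<otimes> inv y \<otimes> inv x)"
      by (simp add: m_assoc inv_mult_group)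
    with that show ?thesis
      unfolding commutator_subgroup_def by (auto intro!: generate.inv)
  qed
  then show ?thesis
    unfolding commutator_subgroup_def[of G X Y]
    by (intro generate_subgroup_incl)
      (auto simp: commutator_subgroup_def intro: generate_is_subgroup[OF YX])
qed

lemma (in group) commutator_subgroup_commute:
  assumes "X \<subseteq> carrier G" "Y \<subseteq> carrier G"
  shows "commutator_subgroup G X Y = commutator_subgroup G Y X"
  using commutator_subgroup_commute_subset[OF assms]
    commutator_subgroup_commute_subset[OF assms(2,1)] by (rule equalityI)

text \<open>Derived words are multilinear: a tree distributes over joins of normal subgroups in each
  leaf. Bounding the tree by an arbitrary normal \<open>T\<close> lets the induction descend into a branch,
  with \<open>T\<close> replaced by its residual with respect to the other branch.\<close>

lemma (in group) commutator_tree_join: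
  assumes "\<And>q. f q \<lhd> G" "\<And>M. M \<in> \<M> \<Longrightarrow> M \<lhd> G" "T \<lhd> G" "length p = n"
    and "\<And>M. M \<in> \<M> \<Longrightarrow> commutator_tree G n (f(p := M)) \<subseteq> T"
  shows "commutator_tree G n (f(p := generate G (\<Union>\<M>))) \<subseteq> T"
  using assms
proof (induction n arbitrary: f p T)
  case 0
  then have "\<Union>\<M> \<subseteq> T" by auto
  with 0 show ?case by (simp add: generate_subgroup_incl normal_imp_subgroup)
next
  case (Suc n)
  from Suc.prems(4) obtain b q where p: "p = b # q" and q: "length q = n"
    by (cases p) auto
  let ?J = "generate G (\<Union>\<M>)"
  let ?X = "\<lambda>M. commutator_tree G n ((\<lambda>r. f (b # r))(q := M))"
  let ?Y = "commutator_tree G n (\<lambda>r. f ((\<not> b) # r))"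
  have MG: "\<Union>\<M> \<subseteq> carrier G" using Suc.prems(2) normal_imp_subgroup subgroup.subset by blast
  have J: "?J \<lhd> G"
    by (rule normal_generateI[OF MG]) (use Suc.prems(2) in \<open>auto simp: normal_inv_iff\<close>)
  have Y: "?Y \<lhd> G" by (rule commutator_tree_normal) (rule Suc.prems)
  have X: "?X M \<lhd> G" if "M \<lhd> G" for M
    using that Suc.prems(1) by (intro commutator_tree_normal) simp
  have sub: "A \<subseteq> carrier G" if "A \<lhd> G" for A
    using that normal_imp_subgroup subgroup.subset by blast
  have tree: "commutator_tree G (Suc n) (f(p := M)) = commutator_subgroup G (?X M) ?Y"
    if M: "M \<lhd> G" for M
  proof -
    have "(\<lambda>r. (f(p := M)) (b # r)) = (\<lambda>r. f (b # r))(q := M)"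
      "(\<lambda>r. (f(p := M)) ((\<not> b) # r)) = (\<lambda>r. f ((\<not> b) # r))" by (auto simp: p)
    then show ?thesis
      using commutator_subgroup_commute[OF sub[OF X[OF M]] sub[OF Y]]
      by (cases b) simp_all
  qed
  have subT: "subgroup T G" using Suc.prems(3) by (rule normal_imp_subgroup)
  have "?X ?J \<subseteq> commutator_residual G ?Y T"
  proof (rule Suc.IH)
    show "commutator_residual G ?Y T \<lhd> G"
      using Y Suc.prems(3) by (rule commutator_residual_normal)
    show "?X M \<subseteq> commutator_residual G ?Y T" if "M \<in> \<M>" for M
      using Suc.prems(5)[OF that] tree[OF Suc.prems(2)[OF that]]
        commutator_subgroup_subset_iff[OF sub[OF X[OF Suc.prems(2)[OF that]]] subT] by simp
  qed (use Suc.prems q in auto)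
  then show ?case
    using tree[OF J] commutator_subgroup_subset_iff[OF sub[OF X[OF J]] subT] by simp
qed


section \<open>Large characteristic subgroups of bounded derived length\<close>

definition characteristic :: "'a set \<Rightarrow> ('a, 'b) monoid_scheme \<Rightarrow> bool"
  where "characteristic R G \<longleftrightarrow> R \<subseteq> carrier G \<and> (\<forall>\<phi>\<in>iso G G. \<phi> ` R = R)"

lemma characteristicD: "\<lbrakk>characteristic R G; \<phi> \<in> iso G G\<rbrakk> \<Longrightarrow> \<phi> ` R = R"
  by (simp add: characteristic_def)

lemma (in group) iso_group_hom: "\<phi> \<in> iso G G \<Longrightarrow> group_hom G G \<phi>"
  by (auto simp: group_hom_def group_hom_axioms_def iso_def is_group)

lemma (in group) iso_img_normal:
  assumes \<phi>: "\<phi> \<in> iso G G" and N: "N \<lhd> G"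
  shows "\<phi> ` N \<lhd> G"
proof (rule normal_invI)
  interpret \<phi>: group_hom G G \<phi> using \<phi> by (rule iso_group_hom)
  show "subgroup (\<phi> ` N) G" using N by (intro \<phi>.subgroup_img_is_subgroup normal_imp_subgroup)
  fix g y assume g: "g \<in> carrier G" and "y \<in> \<phi> ` N"
  then obtain n where n: "n \<in> N" "y = \<phi> n" by blast
  obtain k where k: "k \<in> carrier G" "g = \<phi> k"
    using \<phi> g by (auto simp: iso_def bij_betw_def)
  have "n \<in> carrier G" using n N normal_imp_subgroup subgroup.subset by blast
  then have "g \<otimes> y \<otimes> inv g = \<phi> (k \<otimes> n \<otimes> inv k)" using n k by simp
  moreover have "k \<otimes> n \<otimes> inv k \<in> N" using N n k by (auto simp: normal_inv_iff)
  ultimately show "g \<otimes> y \<otimes> inv g \<in> \<phi> ` N" by blast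
qed

lemma (in group) iso_img_finite_index:
  assumes \<phi>: "\<phi> \<in> iso G G" and N: "finite_index_subgroup N G"
  shows "finite_index_subgroup (\<phi> ` N) G"
proof -
  let ?\<psi> = "inv_into (carrier G) \<phi>"
  interpret \<psi>: group_hom G G ?\<psi> using iso_set_sym[OF \<phi>] by (rule iso_group_hom)
  have NG: "N \<subseteq> carrier G"
    using N finite_index_subgroup_imp_subgroup subgroup.subset by blast
  have bij: "inj_on \<phi> (carrier G)" "\<phi> ` carrier G = carrier G"
    using \<phi> by (auto simp: iso_def bij_betw_def)
  have "\<phi> ` N = {x \<in> carrier G. ?\<psi> x \<in> N}"
  proof (intro equalityI subsetI)
    show "x \<in> {x \<in> carrier G. ?\<psi> x \<in> N}" if "x \<in> \<phi> ` N" for x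
      using that NG bij by (auto simp: inv_into_f_f subset_iff)
    show "x \<in> \<phi> ` N" if "x \<in> {x \<in> carrier G. ?\<psi> x \<in> N}" for x
      using that bij by (metis (mono_tags, lifting) f_inv_into_f imageI mem_Collect_eq)
  qed
  then show ?thesis using \<psi>.finite_index_preimage[OF N] by simp
qed

lemma (in group) characteristicI:
  assumes RG: "R \<subseteq> carrier G" and R: "\<And>\<phi>. \<phi> \<in> iso G G \<Longrightarrow> \<phi> ` R \<subseteq> R"
  shows "characteristic R G"
  unfolding characteristic_def
proof (intro conjI RG ballI equalityI R)
  fix \<phi> assume \<phi>: "\<phi> \<in> iso G G"
  show "R \<subseteq> \<phi> ` R"
  proof
    fix r assume r: "r \<in> R"
    have "inv_into (carrier G) \<phi> r \<in> R" using R[OF iso_set_sym[OF \<phi>]] r by blast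
    moreover have "\<phi> (inv_into (carrier G) \<phi> r) = r"
      using \<phi> r RG by (intro f_inv_into_f) (auto simp: iso_def bij_betw_def)
    ultimately show "r \<in> \<phi> ` R" by (metis imageI)
  qed
qed

lemma (in group) generate_automorphic_images_characteristic:
  assumes N: "N \<subseteq> carrier G"
  defines "R \<equiv> generate G (\<Union>((\<lambda>\<psi>. \<psi> ` N) ` iso G G))"
  shows "characteristic R G"
proof (rule characteristicI)
  let ?U = "\<Union>((\<lambda>\<psi>. \<psi> ` N) ` iso G G)"
  have U: "?U \<subseteq> carrier G" using N by (auto simp: iso_def hom_def)
  then show "R \<subseteq> carrier G" unfolding R_def by (rule generate_incl)
  fix \<psi> assume \<psi>: "\<psi> \<in> iso G G"
  interpret \<psi>: group_hom G G \<psi> using \<psi> by (rule iso_group_hom)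
  have "\<psi> ` ?U \<subseteq> ?U"
  proof
    fix y assume "y \<in> \<psi> ` ?U"
    then obtain \<chi> n where \<chi>: "\<chi> \<in> iso G G" and n: "n \<in> N" and y: "y = \<psi> (\<chi> n)" by blast
    have "\<psi> \<circ> \<chi> \<in> iso G G" using iso_set_trans[OF \<chi> \<psi>] .
    moreover have "y = (\<psi> \<circ> \<chi>) n" by (simp add: y)
    ultimately show "y \<in> ?U" using n by blast
  qed
  then have "generate G (\<psi> ` ?U) \<subseteq> R" unfolding R_def by (rule mono_generate)
  then show "\<psi> ` R \<subseteq> R" unfolding R_def using \<psi>.generate_img[OF U] by simp
qed

text \<open>Induction over the set \<open>K\<close> of leaves that carry a characteristic subgroup. Both \<open>R\<close> and \<open>N\<close>
  shrink at every step; \<open>N \<subseteq> R\<close> is carried along since it makes the next characteristic subgroup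
  a subgroup of \<open>R\<close>, and since it makes \<open>R\<close> inherit the finite index of \<open>N\<close>.\<close>

lemma (in group) commutator_tree_enlarge_leaves:
  assumes f0: "N0 \<lhd> G" "finite_index_subgroup N0 G" "(derived G ^^ n) N0 \<subseteq> {\<one>}"
    and "finite K" "K \<subseteq> {p. length p = n}"
  shows "\<exists>R N. N \<subseteq> R \<and> R \<lhd> G \<and> N \<lhd> G \<and> finite_index_subgroup N G
    \<and> characteristic R G
    \<and> commutator_tree G n (\<lambda>q. if q \<in> K then R else N) \<subseteq> {\<one>}"
  using assms(4,5)
proof (induction K rule: finite_subset_induct')
  case empty
  have "characteristic (carrier G) G"
    by (rule characteristicI) (auto simp: iso_def hom_def)
  moreover have "N0 \<subseteq> carrier G" using f0(1) normal_imp_subgroup subgroup.subset by blast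
  moreover have "commutator_tree G n (\<lambda>q. if q \<in> {} then carrier G else N0) \<subseteq> {\<one>}"
    using f0(3) by (simp add: commutator_tree_const)
  ultimately show ?case using f0(1,2) normal_self by blast
next
  case (insert p K)
  then obtain R N where RN: "N \<subseteq> R" "R \<lhd> G" "N \<lhd> G" "finite_index_subgroup N G"
    and charR: "characteristic R G"
    and tree: "commutator_tree G n (\<lambda>q. if q \<in> K then R else N) \<subseteq> {\<one>}" by blast
  let ?\<M> = "(\<lambda>\<phi>. \<phi> ` N) ` iso G G"
  have NG: "N \<subseteq> carrier G" using RN(3) normal_imp_subgroup subgroup.subset by blast
  have \<M>: "M \<lhd> G \<and> finite_index_subgroup M G \<and> M \<subseteq> carrier G" if M: "M \<in> ?\<M>" for M
  proof -
    have "M \<lhd> G" "finite_index_subgroup M G"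
      using M iso_img_normal[OF _ RN(3)] iso_img_finite_index[OF _ RN(4)] by blast+
    then show ?thesis using normal_imp_subgroup subgroup.subset by blast
  qed
  \<comment> \<open>The identity automorphism puts \<open>N\<close> itself into the family.\<close>
  have "(\<lambda>x. x) \<in> iso G G" by (auto simp: iso_def hom_def bij_betw_def)
  then have "(\<lambda>x. x) ` N \<in> ?\<M>" by blast
  then have "N \<in> ?\<M>" by simp
  from generate_Union_finite_subfamily[OF RN(4) this] \<M>
  obtain F where F: "finite F" "F \<subseteq> ?\<M>" "N \<in> F" "generate G (\<Union>F) = generate G (\<Union>?\<M>)"
    by blast
  define R' where "R' = generate G (\<Union>?\<M>)"
  define N' where "N' = \<Inter>F"
  have N': "finite_index_subgroup N' G" "N' \<lhd> G"
    using finite_index_normal_Inter[OF F(1)] F(2,3) \<M> unfolding N'_def by blast+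
  have R'R: "R' \<subseteq> R" unfolding R'_def
  proof (rule generate_subgroup_incl[OF _ normal_imp_subgroup[OF RN(2)]])
    show "\<Union>?\<M> \<subseteq> R"
    proof (rule Union_least)
      fix M assume "M \<in> ?\<M>"
      then obtain \<phi> where "\<phi> \<in> iso G G" "M = \<phi> ` N" by blast
      with characteristicD[OF charR, of \<phi>] image_mono[OF RN(1), of \<phi>] show "M \<subseteq> R" by simp
    qed
  qed
  have NR': "N \<subseteq> R'" unfolding F(4)[symmetric] R'_def using F(3) by (blast intro: generate.incl)
  have R': "R' \<lhd> G" unfolding R'_def
  proof (rule normal_generateI)
    show "\<Union>?\<M> \<subseteq> carrier G" using \<M> by blast
    show "g \<otimes> h \<otimes> inv g \<in> \<Union>?\<M>" if h: "h \<in> \<Union>?\<M>" and g: "g \<in> carrier G" for h g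
    proof -
      obtain M where M: "M \<in> ?\<M>" "h \<in> M" using h by blast
      then have "g \<otimes> h \<otimes> inv g \<in> M" using \<M>[OF M(1)] g by (auto simp: normal_inv_iff)
      with M(1) show ?thesis by blast
    qed
  qed
  let ?g = "\<lambda>q. if q \<in> K then R' else N'"
  have "commutator_tree G n (?g(p := generate G (\<Union>F))) \<subseteq> {\<one>}"
  proof (rule commutator_tree_join)
    show "?g q \<lhd> G" for q using R' N' by simp
    show "M \<lhd> G" if "M \<in> F" for M using that F(2) \<M> by blast
    show "{\<one>} \<lhd> G" by (rule one_is_normal)
    show "length p = n" using insert by simp
    fix M assume "M \<in> F"
    then obtain \<phi> where \<phi>: "\<phi> \<in> iso G G" and M: "M = \<phi> ` N" using F(2) by blast
    interpret \<phi>: group_hom G G \<phi> using \<phi> by (rule iso_group_hom)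
    \<comment> \<open>Every leaf, the new one included, lies in the image under the same automorphism of the
        subgroup that the previous stage has at this leaf.\<close>
    have "commutator_tree G n (?g(p := M))
        \<subseteq> commutator_tree G n (\<lambda>q. \<phi> ` (if q \<in> K then R else N))"
    proof (rule commutator_tree_mono)
      fix q
      have "N' \<subseteq> M" unfolding N'_def using \<open>M \<in> F\<close> by blast
      then show "(?g(p := M)) q \<subseteq> \<phi> ` (if q \<in> K then R else N)"
        using \<open>p \<notin> K\<close> R'R characteristicD[OF charR \<phi>] M by auto
    qed
    also have "\<dots> = \<phi> ` commutator_tree G n (\<lambda>q. if q \<in> K then R else N)"
      by (rule \<phi>.commutator_tree_img) (simp add: RN)
    also have "\<dots> \<subseteq> {\<one>}" using tree by auto
    finally show "commutator_tree G n (?g(p := M)) \<subseteq> {\<one>}" .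
  qed
  moreover have "?g(p := generate G (\<Union>F)) = (\<lambda>q. if q \<in> insert p K then R' else N')"
    unfolding F(4) R'_def[symmetric] by (simp add: fun_eq_iff)
  moreover have "characteristic R' G"
    unfolding R'_def using NG by (rule generate_automorphic_images_characteristic)
  moreover have "N' \<subseteq> R'" using NR' F(3) unfolding N'_def by blast
  ultimately show ?case using R' N' by (intro exI[of _ R'] exI[of _ N']) simp
qed

text \<open>Passing to the normal core first makes the subgroup normal, as the multilinearity of
  commutator trees requires.\<close>

theorem (in group) finite_index_characteristic_of_derived_length:
  assumes H: "finite_index_subgroup H G" and d: "(derived G ^^ n) H \<subseteq> {\<one>}"
  obtains C where "finite_index_subgroup C G" "(derived G ^^ n) C \<subseteq> {\<one>}"
    "characteristic C G"
proof -
  obtain N0 where N0: "N0 \<subseteq> H" "N0 \<lhd> G" "finite_index_subgroup N0 G"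
    using finite_index_normal_core[OF H] .
  have d0: "(derived G ^^ n) N0 \<subseteq> {\<one>}" using mono_exp_of_derived[OF N0(1)] d by blast
  have "finite {p :: bool list. length p = n}"
    using finite_lists_length_eq[of "UNIV :: bool set" n] by simp
  from commutator_tree_enlarge_leaves[OF N0(2,3) d0 this]
  obtain R N where RN: "N \<subseteq> R" "R \<lhd> G" "finite_index_subgroup N G"
    and charR: "characteristic R G"
    and tree: "commutator_tree G n (\<lambda>q. if q \<in> {p. length p = n} then R else N) \<subseteq> {\<one>}"
    by blast
  have "(derived G ^^ n) R \<subseteq> commutator_tree G n (\<lambda>q. if q \<in> {p. length p = n} then R else N)"
    unfolding commutator_tree_const[symmetric] by (rule commutator_tree_mono) simp
  with tree have "(derived G ^^ n) R \<subseteq> {\<one>}" by blast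
  moreover have "finite_index_subgroup R G"
    using RN by (meson finite_index_superset normal_imp_subgroup)
  ultimately show ?thesis using that charR by blast
qed


section \<open>Extensions of virtually solvable groups\<close>

lemma (in group) exp_of_derived_consistent:
  assumes "subgroup H G" "K \<subseteq> H"
  shows "(derived (G\<lparr>carrier := H\<rparr>) ^^ n) K = (derived G ^^ n) K \<and> (derived G ^^ n) K \<subseteq> H"
proof (induction n)
  case (Suc n)
  then show ?case using derived_consistent[OF _ assms(1)] derived_incl[OF _ assms(1)] by simp
qed (use assms in simp)

lemma (in group) virtually_solvableE:
  assumes "virtually_solvable_of_derived_length G k"
  obtains H where "finite_index_subgroup H G" "(derived G ^^ k) H = {\<one>}"
proof -
  obtain H where H: "finite_index_subgroup H G" "solvable (G\<lparr>carrier := H\<rparr>)"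
      "derived_length (G\<lparr>carrier := H\<rparr>) = k"
    using assms unfolding virtually_solvable_of_derived_length_def by blast
  have sub: "subgroup H G" using H(1) by (rule finite_index_subgroup_imp_subgroup)
  interpret H: group "G\<lparr>carrier := H\<rparr>" using sub by (rule subgroup_imp_group)
  have "\<exists>n. (derived (G\<lparr>carrier := H\<rparr>) ^^ n) H = {\<one>}"
    using H(2) H.solvable_iff_trivial_derived_seq by simp
  then have "(derived (G\<lparr>carrier := H\<rparr>) ^^ k) H = {\<one>}"
    using LeastI_ex[of "\<lambda>n. (derived (G\<lparr>carrier := H\<rparr>) ^^ n) H = {\<one>}"] H(3)
    by (simp add: derived_length_def)
  then show ?thesis using that H(1) exp_of_derived_consistent[OF sub] by simp
qed

lemma (in group) solvable_derived_lengthI: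
  assumes H: "subgroup H G" and d: "(derived G ^^ n) H \<subseteq> {\<one>}"
  shows "solvable (G\<lparr>carrier := H\<rparr>) \<and> derived_length (G\<lparr>carrier := H\<rparr>) \<le> n"
proof -
  interpret H: group "G\<lparr>carrier := H\<rparr>" using H by (rule subgroup_imp_group)
  have "(derived G ^^ n) H = {\<one>}"
    using d subgroup.one_closed[OF exp_of_derived_is_subgroup[OF H, of n]] by blast
  then have "(derived (G\<lparr>carrier := H\<rparr>) ^^ n) H = {\<one>}"
    using exp_of_derived_consistent[OF H] by simp
  then show ?thesis
    using H.solvable_iff_trivial_derived_seq unfolding derived_length_def
    by (auto intro: Least_le)
qed

lemma (in group) conjugation_iso_normal:
  assumes A: "A \<lhd> G" and g: "g \<in> carrier G"
  shows "(\<lambda>a. g \<otimes> a \<otimes> inv g) \<in> iso (G\<lparr>carrier := A\<rparr>) (G\<lparr>carrier := A\<rparr>)"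
proof -
  have AG: "\<And>a. a \<in> A \<Longrightarrow> a \<in> carrier G" using A normal_imp_subgroup subgroup.subset by blast
  have conj: "k \<otimes> a \<otimes> inv k \<in> A" if "k \<in> carrier G" "a \<in> A" for k a
    using A that by (auto simp: normal_inv_iff)
  have "bij_betw (\<lambda>a. g \<otimes> a \<otimes> inv g) A A"
  proof (rule bij_betw_byWitness[where f' = "\<lambda>a. inv g \<otimes> a \<otimes> inv (inv g)"])
    show "(\<lambda>a. g \<otimes> a \<otimes> inv g) ` A \<subseteq> A" using conj g by blast
    show "(\<lambda>a. inv g \<otimes> a \<otimes> inv (inv g)) ` A \<subseteq> A" using conj[of "inv g"] g by blast
  qed (use g AG in \<open>auto simp: m_assoc mult_inv_cancel inv_mult_cancel\<close>)
  moreover have "g \<otimes> (a \<otimes> b) \<otimes> inv g = (g \<otimes> a \<otimes> inv g) \<otimes> (g \<otimes> b \<otimes> inv g)"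
    if "a \<in> A" "b \<in> A" for a b
    using g AG that by (simp add: m_assoc mult_inv_cancel inv_mult_cancel)
  ultimately show ?thesis using conj g by (auto simp: iso_def hom_def)
qed

text \<open>The group acts by conjugation on the finite set of cosets of \<open>C\<close> in \<open>A\<close>. The residual
  of \<open>A\<close> and \<open>C\<close> is the centralizer of \<open>A / C\<close>, that is, the kernel of this action.\<close>

lemma (in group) finite_index_centralizer_of_finite_section:
  assumes A: "A \<lhd> G" and C: "C \<lhd> G" "C \<subseteq> A" and fin: "finite (rcosets\<^bsub>G\<lparr>carrier := A\<rparr>\<^esub> C)"
  shows "finite_index_subgroup (commutator_residual G A C) G"
proof (rule finite_index_subgroupI)
  let ?Q = "rcosets\<^bsub>G\<lparr>carrier := A\<rparr>\<^esub> C"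
  let ?f = "\<lambda>g. \<lambda>D\<in>?Q. (\<lambda>a. g \<otimes> a \<otimes> inv g) ` D"
  have AG: "\<And>a. a \<in> A \<Longrightarrow> a \<in> carrier G" using A normal_imp_subgroup subgroup.subset by blast
  have conjA: "k \<otimes> a \<otimes> inv k \<in> A" if "k \<in> carrier G" "a \<in> A" for k a
    using A that by (auto simp: normal_inv_iff)
  have conjC: "k \<otimes> a \<otimes> inv k \<in> C" if "k \<in> carrier G" "a \<in> C" for k a
    using C(1) that by (auto simp: normal_inv_iff)
  have CG: "\<And>c. c \<in> C \<Longrightarrow> c \<in> carrier G" using C(2) AG by blast
  have Q: "?Q = (\<lambda>a. C #> a) ` A" by (auto simp: RCOSETS_def r_coset_def)
  show "subgroup (commutator_residual G A C) G"
    using commutator_residual_normal[OF A C(1)] by (rule normal_imp_subgroup)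
  have img: "(\<lambda>x. g \<otimes> x \<otimes> inv g) ` (C #> a) = C #> (g \<otimes> a \<otimes> inv g)"
    if g: "g \<in> carrier G" and a: "a \<in> A" for g a
  proof (intro equalityI subsetI)
    fix y assume "y \<in> (\<lambda>x. g \<otimes> x \<otimes> inv g) ` (C #> a)"
    then obtain c where c: "c \<in> C" "y = g \<otimes> (c \<otimes> a) \<otimes> inv g" by (auto simp: r_coset_def)
    have "y = (g \<otimes> c \<otimes> inv g) \<otimes> (g \<otimes> a \<otimes> inv g)"
      using g AG[OF a] CG[OF c(1)] by (simp add: c(2) m_assoc mult_inv_cancel inv_mult_cancel)
    then show "y \<in> C #> (g \<otimes> a \<otimes> inv g)" using conjC[OF g c(1)] by (auto simp: r_coset_def)
  next
    fix y assume "y \<in> C #> (g \<otimes> a \<otimes> inv g)"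
    then obtain c where c: "c \<in> C" "y = c \<otimes> (g \<otimes> a \<otimes> inv g)" by (auto simp: r_coset_def)
    let ?c = "inv g \<otimes> c \<otimes> inv (inv g)"
    have "y = g \<otimes> (?c \<otimes> a) \<otimes> inv g"
      using g AG[OF a] CG[OF c(1)] by (simp add: c(2) m_assoc mult_inv_cancel inv_mult_cancel)
    moreover have "?c \<in> C" using conjC[of "inv g"] g c by simp
    ultimately show "y \<in> (\<lambda>x. g \<otimes> x \<otimes> inv g) ` (C #> a)" by (auto simp: r_coset_def)
  qed
  have "?f ` carrier G \<subseteq> ?Q \<rightarrow>\<^sub>E ?Q" using img conjA by (auto simp: Q)
  then show "finite (?f ` carrier G)" by (rule finite_subset) (simp add: fin finite_PiE)
  fix g k assume g: "g \<in> carrier G" and k: "k \<in> carrier G" and eq: "?f g = ?f k"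
  have "(g \<otimes> inv k) \<otimes> a \<otimes> inv (g \<otimes> inv k) \<otimes> inv a \<in> C" if a: "a \<in> A" for a
  proof -
    \<comment> \<open>Chosen so that conjugation by \<open>k\<close> takes it to \<open>a\<close>, and conjugation by \<open>g\<close> to the
        conjugate of \<open>a\<close> by \<open>g \<otimes> inv k\<close>.\<close>
    let ?b = "inv k \<otimes> a \<otimes> inv (inv k)"
    have b: "?b \<in> A" using conjA[of "inv k"] k a by simp
    then have "C #> ?b \<in> ?Q" by (auto simp: Q)
    from fun_cong[OF eq, of "C #> ?b"] this
    have "C #> (g \<otimes> ?b \<otimes> inv g) = C #> (k \<otimes> ?b \<otimes> inv k)"
      using img[OF g b] img[OF k b] by simp
    moreover have "k \<otimes> ?b \<otimes> inv k = a"
      using k AG[OF a] by (simp add: m_assoc mult_inv_cancel inv_mult_cancel)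
    ultimately have "(g \<otimes> ?b \<otimes> inv g) \<otimes> inv a \<in> C"
      using rcos_eq_iff[OF normal_imp_subgroup[OF C(1)]] g k AG[OF a] by simp
    then show ?thesis using g k AG[OF a] by (simp add: m_assoc inv_mult_group)
  qed
  with g k show "g \<otimes> inv k \<in> commutator_residual G A C" by (simp add: commutator_residual_def)
qed

theorem theorem5:
  fixes G :: "('a, 'b) monoid_scheme" and A :: "'a set" and s t :: nat
  assumes "group G"
    and "A \<lhd> G"
    and "virtually_solvable_of_derived_length (G\<lparr>carrier := A\<rparr>) s"
    and "virtually_solvable_of_derived_length (G Mod A) t"
  shows "\<exists>H. finite_index_subgroup H G \<and> solvable (G\<lparr>carrier := H\<rparr>) \<and>
             derived_length (G\<lparr>carrier := H\<rparr>) \<le> t + s + 1"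
proof -
  interpret group G by fact
  interpret A: normal A G by fact
  have subA: "subgroup A G" using assms(2) by (rule normal_imp_subgroup)
  let ?A = "G\<lparr>carrier := A\<rparr>"
  interpret GA: group ?A using subA by (rule subgroup_imp_group)
  interpret Q: group "G Mod A" by (rule A.factorgroup_is_group)
  interpret \<pi>: group_hom G "G Mod A" "\<lambda>g. A #>\<^bsub>G\<^esub> g"
    by (simp add: group_hom_def group_hom_axioms_def A.r_coset_hom_Mod A.factorgroup_is_group)

  obtain B where B: "finite_index_subgroup B ?A" "(derived ?A ^^ s) B = {\<one>\<^bsub>?A\<^esub>}"
    using GA.virtually_solvableE[OF assms(3)] .
  obtain C where C: "finite_index_subgroup C ?A" "(derived ?A ^^ s) C \<subseteq> {\<one>\<^bsub>?A\<^esub>}"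
    and charC: "characteristic C ?A"
    using GA.finite_index_characteristic_of_derived_length[OF B(1)] B(2) by (metis order_refl)
  have subCA: "subgroup C ?A" using C(1) by (rule finite_index_subgroup_imp_subgroup)
  have CA: "C \<subseteq> A" using subgroup.subset[OF subCA] by simp
  have nC: "C \<lhd> G"
  proof (rule normal_invI[OF incl_subgroup[OF subA subCA]])
    show "g \<otimes>\<^bsub>G\<^esub> c \<otimes>\<^bsub>G\<^esub> inv\<^bsub>G\<^esub> g \<in> C" if "g \<in> carrier G" "c \<in> C" for g c
      using characteristicD[OF charC conjugation_iso_normal[OF assms(2) that(1)]] that(2) by blast
  qed
  have dC: "(derived G ^^ s) C \<subseteq> {\<one>\<^bsub>G\<^esub>}"
    using C(2) exp_of_derived_consistent[OF subA CA] by simp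

  obtain T where T: "finite_index_subgroup T (G Mod A)" "(derived (G Mod A) ^^ t) T = {\<one>\<^bsub>G Mod A\<^esub>}"
    using Q.virtually_solvableE[OF assms(4)] .
  define T' where "T' = {g \<in> carrier G. A #>\<^bsub>G\<^esub> g \<in> T}"
  define K where "K = commutator_residual G A C"
  have T': "finite_index_subgroup T' G"
    unfolding T'_def by (rule \<pi>.finite_index_preimage[OF T(1)])
  have K: "finite_index_subgroup K G" unfolding K_def
    using finite_index_centralizer_of_finite_section[OF assms(2) nC CA] C(1)
    by (simp add: finite_index_subgroup_def)
  define H where "H = T' \<inter> K"
  have H: "finite_index_subgroup H G" unfolding H_def using T' K by (rule finite_index_Int)
  have subH: "subgroup H G" using H by (rule finite_index_subgroup_imp_subgroup)
  have subK: "subgroup K G" using K by (rule finite_index_subgroup_imp_subgroup)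

  have dA: "(derived G ^^ t) H \<subseteq> A"
  proof
    fix x assume x: "x \<in> (derived G ^^ t) H"
    have xG: "x \<in> carrier G" using x exp_of_derived_in_carrier[OF subgroup.subset[OF subH]] by blast
    have "(\<lambda>g. A #>\<^bsub>G\<^esub> g) ` (derived G ^^ t) H = (derived (G Mod A) ^^ t) ((\<lambda>g. A #>\<^bsub>G\<^esub> g) ` H)"
      using \<pi>.exp_of_derived_img[OF subgroup.subset[OF subH]] by simp
    also have "\<dots> \<subseteq> (derived (G Mod A) ^^ t) T"
      by (rule Q.mono_exp_of_derived) (auto simp: H_def T'_def)
    finally have "A #>\<^bsub>G\<^esub> x = A" using x T(2) by auto
    then show "x \<in> A" using rcos_self[OF xG subA] by simp
  qed
  have dK: "(derived G ^^ t) H \<subseteq> K"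
    using exp_of_derived_consistent[OF subK, of H] by (simp add: H_def)
  have "derived_set G ((derived G ^^ t) H) \<subseteq> C"
    using dA dK by (auto simp: K_def commutator_residual_def)
  then have "derived G ((derived G ^^ t) H) \<subseteq> C"
    unfolding derived_def[of G "(derived G ^^ t) H"]
    using normal_imp_subgroup[OF nC] by (rule generate_subgroup_incl)
  then have "(derived G ^^ s) (derived G ((derived G ^^ t) H)) \<subseteq> {\<one>\<^bsub>G\<^esub>}"
    using mono_exp_of_derived dC by blast
  moreover have "(derived G ^^ s) (derived G ((derived G ^^ t) H)) = (derived G ^^ (t + s + 1)) H"
    using funpow_add[of s "Suc t" "derived G"] by (simp add: add.commute)
  ultimately have "(derived G ^^ (t + s + 1)) H \<subseteq> {\<one>\<^bsub>G\<^esub>}" by simp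
  with H solvable_derived_lengthI[OF subH] show ?thesis by blast
qed

end
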